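(* Let $N\ge2$ and let $z_{1,N}<\dots<z_{N,N}$ be the zeros of the Hermite polynomial $\tilde H_N$. Then, for all $i,j=1,\dots,N$, $$(-1)^{i+j}\left(\sum_{k=0}^{N-1}\tilde H_k(z_{i,N})^2\ \sum_{l=0}^{N-1}\tilde H_l(z_{j,N})^2\right)^{1/2}\sum_{k=0}^{N-1}\frac{\tilde H_k(z_{i,N})\tilde H_k(z_{j,N})}{N-k}$$ $$=\sum_{l=0}^{N-1}\tilde H_l^2(z_{i,N})\tilde H_l^2(z_{j,N})+\sum_{l=0}^{N-2}\tilde H_{l+1}(z_{i,N})\tilde H_l(z_{i,N})\tilde H_{l+1}(z_{j,N})\tilde H_l(z_{j,N}).$$
   Context: $\tilde H_n=\frac{1}{2^{n/2}\sqrt{n!}}H_n$, where $H_n$ is the physicists' Hermite polynomial; i.e. the $\tilde H_n$ are orthonormal with respect to the probability measure $\pi^{-1/2}e^{-x^2}dx$ on $\mathbb R$ and have positive leading coefficients. *)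

theory Defs
  imports "HOL-Analysis.Analysis" "HOL-Computational_Algebra.Polynomial"
begin

text \<open>The physicists' Hermite polynomials, by their three-term recurrence;
  \<open>Hermite_Rodrigues\<close> below identifies them with Rodrigues' formula.\<close>

fun Hermite :: "nat \<Rightarrow> real poly" where
  "Hermite 0 = 1"
| "Hermite (Suc 0) = [:0, 2:]"
| "Hermite (Suc (Suc n)) = [:0, 2:] * Hermite (Suc n) - smult (2 * real (Suc n)) (Hermite n)"

definition Hermite_normalized :: "nat \<Rightarrow> real poly" where
  "Hermite_normalized n = smult (1 / (2 powr (real n / 2) * sqrt (fact n))) (Hermite n)"

lemma pderiv_Hermite_Suc: "pderiv (Hermite (Suc n)) = smult (2 * real (Suc n)) (Hermite n)"
proof (induction n rule: Hermite.induct)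
  case 1
  show ?case by (simp add: pderiv_pCons)
next
  case 2
  show ?case by (simp add: pderiv_pCons pderiv_diff pderiv_mult pderiv_smult)
next
  case (3 n)
  have "pderiv (Hermite (Suc (Suc (Suc n)))) =
      pderiv [:0, 2:] * Hermite (Suc (Suc n)) + [:0, 2:] * pderiv (Hermite (Suc (Suc n)))
      - smult (2 * real (Suc (Suc n))) (pderiv (Hermite (Suc n)))"
    by (subst Hermite.simps(3)) (simp only: pderiv_diff pderiv_mult pderiv_smult mult.commute add.commute)
  also have "\<dots> = smult 2 (Hermite (Suc (Suc n)))
      + smult (2 * real (Suc (Suc n)))
         ([:0, 2:] * Hermite (Suc n) - smult (2 * real (Suc n)) (Hermite n))"
    unfolding 3 by (simp del: Hermite.simps add: pderiv_pCons smult_diff_right)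
  also have "\<dots> = smult (2 * real (Suc (Suc (Suc n)))) (Hermite (Suc (Suc n)))"
    by (simp only: Hermite.simps(3)[symmetric] smult_add_left[symmetric]) (simp add: algebra_simps)
  finally show ?case .
qed

lemma Hermite_Suc: "Hermite (Suc n) = [:0, 2:] * Hermite n - pderiv (Hermite n)"
proof (cases n)
  case (Suc m)
  then show ?thesis by (simp only: Hermite.simps(3) pderiv_Hermite_Suc)
qed simp

lemma Hermite_Rodrigues:
  "(deriv ^^ n) (\<lambda>x::real. exp (- x\<^sup>2)) = (\<lambda>x. (-1) ^ n * poly (Hermite n) x * exp (- x\<^sup>2))"
proof (induction n)
  case (Suc n)
  have "deriv (\<lambda>x. (-1) ^ n * poly (Hermite n) x * exp (- x\<^sup>2)) x =
      (-1) ^ Suc n * poly (Hermite (Suc n)) x * exp (- x\<^sup>2)" for x :: real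
    by (rule DERIV_imp_deriv)
      (auto intro!: derivative_eq_intros poly_DERIV simp: Hermite_Suc algebra_simps)
  then show ?case by (simp add: Suc fun_eq_iff)
qed simp

end

theory Submission
  imports Defs
begin

text \<open>
  Write \<open>a\<^sub>k\<close>, \<open>c\<^sub>k\<close> for the values of the normalized Hermite polynomials \<open>h\<^sub>k\<close> at \<open>x\<close>, \<open>y\<close>. The
  weights \<open>1 / (N - k)\<close> come from the quotients
  \<open>A k m = (h\<^sub>k' h\<^sub>m - h\<^sub>k h\<^sub>m')(y) / (k - m)\<close>: if \<open>h\<^sub>N(y) = 0\<close>, the numerator for \<open>k = N\<close> is a multiple of
  \<open>h\<^sub>N\<^sub>-\<^sub>1(y) h\<^sub>m(y)\<close>. As \<open>A k m\<close> is essentially the integral of \<open>h\<^sub>k h\<^sub>m e^(-s^2)\<close> over \<open>s \<le> y\<close>, it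
  inherits the symmetry of multiplication by \<open>s\<close>. Hence \<open>Q\<^sub>k = (\<Sum>m<k. a\<^sub>m A k m)\<close> satisfies the
  recurrence of the \<open>a\<^sub>k\<close> up to the source \<open>c\<^sub>k\<^sup>2 a\<^sub>k + c\<^sub>k c\<^sub>k\<^sub>-\<^sub>1 a\<^sub>k\<^sub>-\<^sub>1\<close>, and the Casoratian of \<open>Q\<close> and \<open>a\<close>
  telescopes to the right-hand side. The Christoffel-Darboux formula and the sign
  \<open>(-1)^(N-i)\<close> of \<open>h\<^sub>N\<^sub>-\<^sub>1\<close> at the \<open>i\<close>-th zero of \<open>h\<^sub>N\<close> turn the factor \<open>N h\<^sub>N\<^sub>-\<^sub>1(x) h\<^sub>N\<^sub>-\<^sub>1(y)\<close> on the
  other side into the signed square root.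
\<close>

section \<open>Three-term recurrences and Wronskian quotients\<close>

definition jacobi_offdiag :: "nat \<Rightarrow> real" where
  "jacobi_offdiag k = sqrt (real k / 2)"

definition hermite_recurrence :: "real \<Rightarrow> (nat \<Rightarrow> real) \<Rightarrow> bool" where
  "hermite_recurrence x a \<longleftrightarrow>
     (\<forall>k. jacobi_offdiag (Suc k) * a (Suc k) = x * a k - jacobi_offdiag k * a (k - 1))"

text \<open>\<open>h\<^sub>k' h\<^sub>m - h\<^sub>k h\<^sub>m'\<close> with the derivatives eliminated by \<open>h\<^sub>k' = 2 r\<^sub>k h\<^sub>k\<^sub>-\<^sub>1\<close>, where
  \<open>r = jacobi_offdiag\<close>. As \<open>r\<^sub>0 = 0\<close>, the truncated index \<open>k - 1\<close> at \<open>k = 0\<close> is harmless, here and in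
  the recurrence above.\<close>

definition wronskian :: "(nat \<Rightarrow> real) \<Rightarrow> nat \<Rightarrow> nat \<Rightarrow> real" where
  "wronskian c k m =
     2 * (jacobi_offdiag k * c (k - 1) * c m - jacobi_offdiag m * c k * c (m - 1))"

text \<open>On the diagonal this is \<open>0\<close> by division by zero, not the integral;
  \<open>wronskian_sum\<close> stays off the diagonal.\<close>

definition wronskian_quot :: "(nat \<Rightarrow> real) \<Rightarrow> nat \<Rightarrow> nat \<Rightarrow> real" where
  "wronskian_quot c k m = wronskian c k m / (real k - real m)"

definition wronskian_sum :: "(nat \<Rightarrow> real) \<Rightarrow> (nat \<Rightarrow> real) \<Rightarrow> nat \<Rightarrow> real" where
  "wronskian_sum a c k = (\<Sum>m<k. a m * wronskian_quot c k m)"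

lemma jacobi_offdiag_0 [simp]: "jacobi_offdiag 0 = 0"
  by (simp add: jacobi_offdiag_def)

lemma jacobi_offdiag_square: "jacobi_offdiag k * jacobi_offdiag k = real k / 2"
  by (simp add: jacobi_offdiag_def)

lemma wronskian_quot_commute: "wronskian_quot c k m = wronskian_quot c m k"
proof -
  have "wronskian c k m = - wronskian c m k"
    by (simp add: wronskian_def algebra_simps)
  then show ?thesis
    by (simp add: wronskian_quot_def minus_divide_left[symmetric] minus_divide_right)
qed

lemma wronskian_Suc:
  assumes "hermite_recurrence y c"
  shows "jacobi_offdiag (Suc k) * wronskian c (Suc k) m - jacobi_offdiag m * wronskian c k (m - 1)
       = (real (Suc k) - real m) * c k * c m"
proof -
  let ?r = jacobi_offdiag
  have rec: "?r (Suc l) * c (Suc l) = y * c l - ?r l * c (l - 1)" for l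
    using assms by (simp add: hermite_recurrence_def)
  show ?thesis
  proof (cases m)
    case 0
    have "?r (Suc k) * wronskian c (Suc k) m = 2 * (?r (Suc k) * ?r (Suc k)) * c k * c 0"
      by (simp add: wronskian_def 0)
    then show ?thesis by (simp add: 0 jacobi_offdiag_square field_simps)
  next
    case (Suc l)
    have "?r (Suc k) * wronskian c (Suc k) m - ?r m * wronskian c k (m - 1)
        = 2 * (?r (Suc k) * ?r (Suc k)) * c k * c (Suc l)
          - 2 * ?r (Suc l) * c l * (?r (Suc k) * c (Suc k))
          - 2 * ?r (Suc l) * ?r k * c (k - 1) * c l
          + 2 * ?r (Suc l) * c k * (?r l * c (l - 1))"
      by (simp add: wronskian_def Suc algebra_simps)
    \<comment> \<open>The recurrence is inserted at \<open>k\<close> and at \<open>l\<close> so that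
      all terms in \<open>y\<close> and in \<open>c (k - 1)\<close> cancel.\<close>
    also have "\<dots> = 2 * (?r (Suc k) * ?r (Suc k)) * c k * c (Suc l)
          - 2 * ?r (Suc l) * c l * (y * c k - ?r k * c (k - 1))
          - 2 * ?r (Suc l) * ?r k * c (k - 1) * c l
          + 2 * ?r (Suc l) * c k * (y * c l - ?r (Suc l) * c (Suc l))"
      using rec[of k] rec[of l] by simp
    also have "\<dots> = 2 * (?r (Suc k) * ?r (Suc k)) * c k * c (Suc l)
          - 2 * (?r (Suc l) * ?r (Suc l)) * c k * c (Suc l)"
      by (simp add: algebra_simps)
    also have "\<dots> = (real (Suc k) - real m) * c k * c m"
      by (simp add: jacobi_offdiag_square Suc field_simps)
    finally show ?thesis .
  qed
qed

text \<open>In the integral picture this is integration by parts, from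
  \<open>(h_k e^(-s^2))' = - 2 r_(k+1) h_(k+1) e^(-s^2)\<close> and
  \<open>h_m' = 2 r_m h_(m-1)\<close>; \<open>c k * c m\<close> is the boundary term at
  \<open>y\<close>.\<close>

lemma wronskian_quot_Suc:
  assumes "hermite_recurrence y c" and "m \<noteq> Suc k"
  shows "jacobi_offdiag (Suc k) * wronskian_quot c (Suc k) m
       = jacobi_offdiag m * wronskian_quot c k (m - 1) + c k * c m"
proof -
  let ?d = "real (Suc k) - real m"
  have nz: "?d \<noteq> 0" using assms(2) by linarith
  \<comment> \<open>For \<open>m = 0\<close> the denominators differ, but both sides vanish with
    \<open>jacobi_offdiag 0\<close>.\<close>
  have quot: "jacobi_offdiag m * wronskian_quot c k (m - 1)
      = jacobi_offdiag m * wronskian c k (m - 1) / ?d"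
    by (cases m) (simp_all add: wronskian_quot_def)
  have "jacobi_offdiag (Suc k) * wronskian c (Suc k) m / ?d
      = (jacobi_offdiag m * wronskian c k (m - 1) + ?d * c k * c m) / ?d"
    using wronskian_Suc[OF assms(1), of k m] by simp
  also have "\<dots> = jacobi_offdiag m * wronskian c k (m - 1) / ?d + c k * c m"
    using nz by (simp add: add_divide_distrib)
  finally show ?thesis
    unfolding quot by (simp add: wronskian_quot_def)
qed

text \<open>Confluent Christoffel-Darboux: each step along the subdiagonal adds one square.\<close>

lemma christoffel_sum:
  assumes "hermite_recurrence y c"
  shows "jacobi_offdiag n * wronskian_quot c n (n - 1) = (\<Sum>k<n. (c k)\<^sup>2)"
proof (induction n)
  case (Suc n)
  have "jacobi_offdiag (Suc n) * wronskian_quot c (Suc n) n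
      = jacobi_offdiag n * wronskian_quot c n (n - 1) + c n * c n"
    by (rule wronskian_quot_Suc[OF assms]) simp
  then show ?case using Suc by (simp add: power2_eq_square)
qed simp

text \<open>Integrating by parts in one index and then in the other leaves \<open>c (Suc k)\<close>
  times two partial sums of \<open>a m * c m\<close>; their difference consists of the terms
  \<open>m = k\<close> and \<open>m = Suc k\<close>, which form the source.\<close>

lemma wronskian_sum_Suc_Suc:
  assumes a: "hermite_recurrence x a" and c: "hermite_recurrence y c"
  shows "jacobi_offdiag (Suc (Suc k)) * wronskian_sum a c (Suc (Suc k))
       = x * wronskian_sum a c (Suc k) - jacobi_offdiag (Suc k) * wronskian_sum a c k
         + (c (Suc k))\<^sup>2 * a (Suc k) + c (Suc k) * c k * a k"
proof -
  let ?r = jacobi_offdiag and ?A = "wronskian_quot c" and ?K = "Suc k"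
  have "?r (Suc ?K) * wronskian_sum a c (Suc ?K)
      = (\<Sum>m<Suc ?K. a m * (?r (Suc ?K) * ?A (Suc ?K) m))"
    by (simp add: wronskian_sum_def sum_distrib_left mult.left_commute del: sum.lessThan_Suc)
  also have "\<dots> = (\<Sum>m<Suc ?K. a m * (?r m * ?A ?K (m - 1) + c ?K * c m))"
    by (intro sum.cong refl) (subst wronskian_quot_Suc[OF c], auto)
  also have "\<dots> = (\<Sum>m<Suc ?K. a m * ?r m * ?A ?K (m - 1)) + c ?K * (\<Sum>m<Suc ?K. a m * c m)"
    by (simp add: sum.distrib[symmetric] sum_distrib_left algebra_simps del: sum.lessThan_Suc)
  \<comment> \<open>The term \<open>m = 0\<close> drops out since \<open>?r 0 = 0\<close>; the shift
    exposes the recurrence of \<open>a\<close>.\<close>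
  also have "(\<Sum>m<Suc ?K. a m * ?r m * ?A ?K (m - 1)) = (\<Sum>m<?K. (?r (Suc m) * a (Suc m)) * ?A ?K m)"
    by (subst sum.lessThan_Suc_shift) (simp add: mult_ac del: sum.lessThan_Suc)
  also have "\<dots> = (\<Sum>m<?K. (x * a m - ?r m * a (m - 1)) * ?A ?K m)"
    using a by (simp add: hermite_recurrence_def del: sum.lessThan_Suc)
  also have "\<dots> = x * wronskian_sum a c ?K - (\<Sum>m<?K. ?r m * a (m - 1) * ?A ?K m)"
    by (simp add: wronskian_sum_def sum_subtractf sum_distrib_left algebra_simps del: sum.lessThan_Suc)
  also have "(\<Sum>m<?K. ?r m * a (m - 1) * ?A ?K m) = (\<Sum>m<k. a m * (?r (Suc m) * ?A (Suc m) ?K))"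
    by (subst sum.lessThan_Suc_shift) (simp add: mult_ac wronskian_quot_commute[of c ?K])
  also have "\<dots> = (\<Sum>m<k. a m * (?r ?K * ?A m k + c m * c ?K))"
    by (intro sum.cong refl) (subst wronskian_quot_Suc[OF c], auto)
  also have "\<dots> = ?r ?K * wronskian_sum a c k + c ?K * (\<Sum>m<k. a m * c m)"
    by (simp add: wronskian_sum_def sum.distrib sum_distrib_left algebra_simps
        wronskian_quot_commute[of c k])
  finally show ?thesis
    by (simp add: algebra_simps power2_eq_square)
qed

lemma wronskian_sum_casoratian:
  assumes a: "hermite_recurrence x a" and c: "hermite_recurrence y c"
  shows "jacobi_offdiag (Suc n) * (wronskian_sum a c (Suc n) * a n - wronskian_sum a c n * a (Suc n))
       = (\<Sum>l\<le>n. (a l)\<^sup>2 * (c l)\<^sup>2) + (\<Sum>l<n. a (Suc l) * a l * c (Suc l) * c l)"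
proof (induction n)
  case 0
  have "jacobi_offdiag (Suc 0) * wronskian_quot c (Suc 0) 0 = c 0 * c 0"
    using wronskian_quot_Suc[OF c, of 0 0] by simp
  then show ?case
    by (simp add: wronskian_sum_def power2_eq_square)
next
  case (Suc n)
  let ?r = jacobi_offdiag and ?Q = "wronskian_sum a c"
  have rec: "?r (Suc (Suc n)) * a (Suc (Suc n)) = x * a (Suc n) - ?r (Suc n) * a n"
    using a by (simp add: hermite_recurrence_def)
  have "?r (Suc (Suc n)) * (?Q (Suc (Suc n)) * a (Suc n) - ?Q (Suc n) * a (Suc (Suc n)))
      = (?r (Suc (Suc n)) * ?Q (Suc (Suc n))) * a (Suc n)
        - ?Q (Suc n) * (?r (Suc (Suc n)) * a (Suc (Suc n)))"
    by (simp add: algebra_simps)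
  also have "\<dots> = ?r (Suc n) * (?Q (Suc n) * a n - ?Q n * a (Suc n))
      + (a (Suc n))\<^sup>2 * (c (Suc n))\<^sup>2 + a (Suc n) * a n * c (Suc n) * c n"
    unfolding rec wronskian_sum_Suc_Suc[OF a c] by (simp add: algebra_simps power2_eq_square)
  finally show ?case
    unfolding Suc by simp
qed

lemma hermite_kernel_identity:
  assumes a: "hermite_recurrence x a" and c: "hermite_recurrence y c"
    and "a (Suc n) = 0" and "c (Suc n) = 0"
  shows "real (Suc n) * a n * c n * (\<Sum>k\<le>n. a k * c k / (real (Suc n) - real k))
       = (\<Sum>l\<le>n. (a l)\<^sup>2 * (c l)\<^sup>2) + (\<Sum>l<n. a (Suc l) * a l * c (Suc l) * c l)"
proof -
  let ?r = "jacobi_offdiag (Suc n)"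
  have "wronskian_sum a c (Suc n) = (\<Sum>k\<le>n. 2 * ?r * c n * (a k * c k / (real (Suc n) - real k)))"
    unfolding wronskian_sum_def lessThan_Suc_atMost
    by (intro sum.cong refl) (simp add: wronskian_quot_def wronskian_def assms(4))
  then have "?r * (wronskian_sum a c (Suc n) * a n)
      = 2 * (?r * ?r) * a n * c n * (\<Sum>k\<le>n. a k * c k / (real (Suc n) - real k))"
    by (simp only: sum_distrib_left[symmetric] mult_ac)
  with wronskian_sum_casoratian[OF a c, of n] show ?thesis
    by (simp add: assms(3) jacobi_offdiag_square field_simps)
qed

lemma christoffel_sum_zero:
  assumes "hermite_recurrence y c" and "c (Suc n) = 0"
  shows "(\<Sum>k\<le>n. (c k)\<^sup>2) = real (Suc n) * (c n)\<^sup>2"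
proof -
  let ?r = "jacobi_offdiag (Suc n)"
  have "(\<Sum>k\<le>n. (c k)\<^sup>2) = 2 * (?r * ?r) * (c n)\<^sup>2"
    using christoffel_sum[OF assms(1), of "Suc n"]
    by (simp add: lessThan_Suc_atMost wronskian_quot_def wronskian_def assms(2) power2_eq_square)
  then show ?thesis
    by (simp add: jacobi_offdiag_square field_simps)
qed

section \<open>Normalized Hermite polynomials satisfy the recurrence\<close>

definition hermite_norm :: "nat \<Rightarrow> real" where
  "hermite_norm n = 1 / (2 powr (real n / 2) * sqrt (fact n))"

lemma Hermite_normalized_eq: "Hermite_normalized n = smult (hermite_norm n) (Hermite n)"
  by (simp add: Hermite_normalized_def hermite_norm_def)

lemma hermite_norm_pos: "hermite_norm n > 0"
  by (simp add: hermite_norm_def)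

lemma hermite_norm_Suc: "2 * jacobi_offdiag (Suc n) * hermite_norm (Suc n) = hermite_norm n"
proof -
  have powr: "(2::real) powr (real (Suc n) / 2) = 2 powr (real n / 2) * sqrt 2"
    by (simp add: add_divide_distrib powr_add powr_half_sqrt)
  have "2 * jacobi_offdiag (Suc n) = sqrt 2 * sqrt (real (Suc n))"
    by (simp add: jacobi_offdiag_def real_sqrt_divide real_div_sqrt field_simps)
  moreover have "hermite_norm (Suc n) * (sqrt 2 * sqrt (real (Suc n))) = hermite_norm n"
    unfolding hermite_norm_def powr by (simp add: real_sqrt_mult del: of_nat_Suc)
  ultimately show ?thesis by (simp add: mult.commute)
qed

lemma hermite_recurrence_Hermite_normalized:
  "hermite_recurrence x (\<lambda>k. poly (Hermite_normalized k) x)"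
  unfolding hermite_recurrence_def
proof
  fix k
  let ?r = jacobi_offdiag and ?h = "\<lambda>k. poly (Hermite_normalized k) x"
  show "?r (Suc k) * ?h (Suc k) = x * ?h k - ?r k * ?h (k - 1)"
  proof (cases k)
    case 0
    then show ?thesis
      using hermite_norm_Suc[of 0] by (simp add: Hermite_normalized_eq algebra_simps)
  next
    case (Suc m)
    have "real (Suc m) = 2 * (?r (Suc m) * ?r (Suc m))"
      by (simp add: jacobi_offdiag_square)
    then have "real (Suc m) * hermite_norm (Suc m)
        = ?r (Suc m) * (2 * ?r (Suc m) * hermite_norm (Suc m))"
      by (simp only: mult_ac)
    then have lower: "real (Suc m) * hermite_norm (Suc m) = ?r (Suc m) * hermite_norm m"
      by (simp only: hermite_norm_Suc)
    have "2 * (?r (Suc k) * ?h (Suc k))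
        = hermite_norm (Suc m) * (2 * x * poly (Hermite (Suc m)) x - 2 * real (Suc m) * poly (Hermite m) x)"
      unfolding Hermite_normalized_eq Suc hermite_norm_Suc[of "Suc m", symmetric]
      by (simp add: algebra_simps)
    also have "\<dots> = 2 * (x * ?h k - (real (Suc m) * hermite_norm (Suc m)) * poly (Hermite m) x)"
      by (simp add: Hermite_normalized_eq Suc algebra_simps del: Hermite.simps)
    also have "\<dots> = 2 * (x * ?h k - ?r k * ?h (k - 1))"
      unfolding lower by (simp add: Hermite_normalized_eq Suc)
    finally show ?thesis by simp
  qed
qed

section \<open>Leading coefficients, derivatives and signs at the zeros\<close>

lemma degree_lead_coeff_Hermite: "degree (Hermite n) = n \<and> lead_coeff (Hermite n) = 2 ^ n"
proof (induction n)
  case (Suc n)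
  then have nz: "Hermite n \<noteq> 0" by auto
  have deg: "degree ([:0, 2:] * Hermite n) = Suc n"
    using conjunct1[OF Suc] nz by (simp add: degree_mult_eq)
  have lc: "lead_coeff ([:0, 2:] * Hermite n) = 2 ^ Suc n"
    unfolding lead_coeff_mult using Suc by auto
  have small: "degree (- pderiv (Hermite n)) < degree ([:0, 2:] * Hermite n)"
    unfolding deg using conjunct1[OF Suc] by (simp add: degree_pderiv)
  have eq: "Hermite (Suc n) = - pderiv (Hermite n) + [:0, 2:] * Hermite n"
    by (simp only: Hermite_Suc diff_conv_add_uminus add.commute)
  show ?case
    unfolding eq using degree_add_eq_right[OF small] lead_coeff_add_le[OF small] deg lc
    by simp
qed simp

lemma pderiv_Hermite_normalized_Suc:
  "pderiv (Hermite_normalized (Suc n)) = smult (2 * jacobi_offdiag (Suc n)) (Hermite_normalized n)"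
  using jacobi_offdiag_square[of "Suc n"]
  by (simp add: Hermite_normalized_eq pderiv_smult pderiv_Hermite_Suc
      hermite_norm_Suc[of n, symmetric] mult_ac del: Hermite.simps of_nat_Suc)

text \<open>As \<open>p\<close> splits over the \<open>z l\<close>, its derivative at
  \<open>z i\<close> is the leading coefficient times the product of \<open>z i - z l\<close> over
  \<open>l \<noteq> i\<close>, with exactly \<open>degree p - i\<close> negative factors.\<close>

lemma poly_pderiv_sign_at_zero:
  fixes p :: "real poly"
  assumes mono: "strict_mono_on {1..degree p} z"
    and zeros: "z ` {1..degree p} = {x. poly p x = 0}"
    and lead: "lead_coeff p > 0" and i: "i \<in> {1..degree p}"
  shows "0 < (-1) ^ (degree p + i) * poly (pderiv p) (z i)"
proof -
  let ?n = "degree p"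
  define q where "q = (\<lambda>A. \<Prod>l\<in>A. [:- z l, 1:])"
  have inj: "inj_on z {1..?n}"
    using mono by (rule strict_mono_on_imp_inj_on)
  have deg: "degree (q {1..?n}) = ?n"
    unfolding q_def by (subst degree_prod_sum_eq) auto
  have lc: "lead_coeff (q A) = 1" for A
    unfolding q_def by (simp add: lead_coeff_prod)
  have poly_q: "poly (q A) x = (\<Prod>l\<in>A. x - z l)" for A x
    by (simp add: q_def poly_prod)
  have "p = smult (lead_coeff p) (q {1..?n})"
  proof (rule poly_eqI_degree_lead_coeff[where A = "z ` {1..?n}" and n = ?n])
    show "coeff p ?n = coeff (smult (lead_coeff p) (q {1..?n})) ?n"
      using lc[of "{1..?n}"] unfolding deg by simp
    show "?n \<le> card (z ` {1..?n})" using inj by (simp add: card_image)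
    show "degree (smult (lead_coeff p) (q {1..?n})) \<le> ?n"
      using deg by simp
    fix x assume x: "x \<in> z ` {1..?n}"
    then have "poly p x = 0" using zeros by blast
    moreover have "poly (q {1..?n}) x = 0" using x by (auto simp: poly_q)
    ultimately show "poly p x = poly (smult (lead_coeff p) (q {1..?n})) x" by simp
  qed simp
  also have "q {1..?n} = [:- z i, 1:] * q ({1..?n} - {i})"
    unfolding q_def using i by (subst prod.remove[of _ i]) auto
  finally have p: "p = [:- z i, 1:] * smult (lead_coeff p) (q ({1..?n} - {i}))"
    by (simp only: mult_smult_right)
  have "poly (pderiv p) (z i) = lead_coeff p * poly (q ({1..?n} - {i})) (z i)"
    by (subst p) (simp only: pderiv_mult, simp add: pderiv_pCons)
  also have "{1..?n} - {i} = {1..<i} \<union> {i<..?n}" using i by auto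
  also have "poly (q ({1..<i} \<union> {i<..?n})) (z i)
      = (\<Prod>l\<in>{1..<i}. z i - z l) * (\<Prod>l\<in>{i<..?n}. z i - z l)"
    unfolding poly_q by (rule prod.union_disjoint) auto
  also have "(\<Prod>l\<in>{i<..?n}. z i - z l) = (\<Prod>l\<in>{i<..?n}. (- 1) * (z l - z i))" by simp
  also have "\<dots> = (- 1) ^ (?n - i) * (\<Prod>l\<in>{i<..?n}. z l - z i)"
    by (simp only: prod.distrib prod_constant card_greaterThanAtMost)
  finally have deriv: "poly (pderiv p) (z i)
      = (- 1) ^ (?n - i) * (lead_coeff p * ((\<Prod>l\<in>{1..<i}. z i - z l) * (\<Prod>l\<in>{i<..?n}. z l - z i)))"
    by (simp only: mult_ac)
  have "(-1::real) ^ (?n + i) * (- 1) ^ (?n - i) = (- 1) ^ (2 * ?n)"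
    unfolding power_add[symmetric] using i by (intro arg_cong2[where f = power]) auto
  then have sign: "(-1::real) ^ (?n + i) * (- 1) ^ (?n - i) = 1" by simp
  have "0 < (\<Prod>l\<in>{1..<i}. z i - z l)"
    using i by (intro prod_pos) (auto intro!: strict_mono_onD[OF mono])
  moreover have "0 < (\<Prod>l\<in>{i<..?n}. z l - z i)"
    using i by (intro prod_pos) (auto intro!: strict_mono_onD[OF mono])
  ultimately show ?thesis
    unfolding deriv mult.assoc[symmetric] sign using lead by simp
qed

theorem corollary4p10:
  fixes N :: nat and z :: "nat \<Rightarrow> real" and i j :: nat
  assumes "N \<ge> 2"
    and "strict_mono_on {1..N} z"
    and "z ` {1..N} = {x. poly (Hermite_normalized N) x = 0}"
    and "i \<in> {1..N}" and "j \<in> {1..N}"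
  shows "(-1) ^ (i + j) *
      sqrt ((\<Sum>k=0..N-1. (poly (Hermite_normalized k) (z i))\<^sup>2) *
            (\<Sum>l=0..N-1. (poly (Hermite_normalized l) (z j))\<^sup>2)) *
      (\<Sum>k=0..N-1. poly (Hermite_normalized k) (z i) * poly (Hermite_normalized k) (z j)
          / (real N - real k))
    = (\<Sum>l=0..N-1. (poly (Hermite_normalized l) (z i))\<^sup>2 * (poly (Hermite_normalized l) (z j))\<^sup>2)
    + (\<Sum>l=0..N-2. poly (Hermite_normalized (l + 1)) (z i) * poly (Hermite_normalized l) (z i)
          * poly (Hermite_normalized (l + 1)) (z j) * poly (Hermite_normalized l) (z j))"
proof -
  let ?h = Hermite_normalized
  obtain n where N: "N = Suc n" using assms(1) by (cases N) auto
  define a c where "a = (\<lambda>k. poly (?h k) (z i))" and "c = (\<lambda>k. poly (?h k) (z j))"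
  have rec: "hermite_recurrence (z i) a" "hermite_recurrence (z j) c"
    unfolding a_def c_def by (rule hermite_recurrence_Hermite_normalized)+
  have zero: "a (Suc n) = 0" "c (Suc n) = 0"
    using assms(3-5) unfolding N a_def c_def by blast+
  have deg: "degree (?h N) = N" and lead: "lead_coeff (?h N) > 0"
    using hermite_norm_pos[of N] degree_lead_coeff_Hermite[of N]
    by (auto simp: Hermite_normalized_eq)
  have sign: "0 < (-1) ^ (N + l) * poly (?h n) (z l)" if "l \<in> {1..N}" for l
  proof -
    have "0 < (-1) ^ (N + l) * poly (pderiv (?h N)) (z l)"
      using poly_pderiv_sign_at_zero[of "?h N" z l] assms(2,3) deg lead that by simp
    also have "\<dots> = 2 * jacobi_offdiag N * ((-1) ^ (N + l) * poly (?h n) (z l))"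
      by (simp add: N pderiv_Hermite_normalized_Suc)
    finally show ?thesis
      by (rule zero_less_mult_pos) (simp add: jacobi_offdiag_def N)
  qed
  have "sqrt ((\<Sum>k\<le>n. (a k)\<^sup>2) * (\<Sum>l\<le>n. (c l)\<^sup>2)) = sqrt ((real N * (a n * c n))\<^sup>2)"
    unfolding christoffel_sum_zero[OF rec(1) zero(1)] christoffel_sum_zero[OF rec(2) zero(2)]
    by (simp add: N power2_eq_square mult_ac)
  also have "\<dots> = real N * \<bar>((-1) ^ (N + i) * a n) * ((-1) ^ (N + j) * c n)\<bar>"
    by (simp add: abs_mult power_abs)
  also have "\<dots> = real N * (((-1) ^ (N + i) * a n) * ((-1) ^ (N + j) * c n))"
    using mult_pos_pos[OF sign[OF assms(4)] sign[OF assms(5)]] by (simp only: a_def c_def abs_of_pos)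
  also have "\<dots> = (-1) ^ (i + j) * (real N * (a n * c n))"
    by (simp add: power_add mult_ac)
  finally have "(-1) ^ (i + j) * sqrt ((\<Sum>k\<le>n. (a k)\<^sup>2) * (\<Sum>l\<le>n. (c l)\<^sup>2)) = real N * a n * c n"
    by simp
  \<comment> \<open>Here \<open>N \<ge> 2\<close> matters: for \<open>N = 1\<close> truncated
    subtraction would turn the empty range into \<open>{0}\<close>.\<close>
  moreover have "{0..N - 2} = {..<n}" "{0..N - 1} = {..n}"
    using assms(1) by (auto simp: N)
  ultimately show ?thesis
    using hermite_kernel_identity[OF rec zero] by (simp only: N a_def c_def Suc_eq_plus1)
qed

end
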